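(* For every $\varepsilon>0$ and every $k\in\mathbb{N}$ there exist $n\in\mathbb{N}$ and a loopless matroid $\mathcal{M}\subseteq 2^{[n]}$ such that no algorithm is $(1/e+\varepsilon)$-competitive for the secretary problem with feasibility constraint $\mathcal{M}\lor\mathcal{U}^k$. Here $\mathcal{U}\subseteq 2^{[n]}$ is the $1$-uniform matroid, i.e. the family of subsets of $[n]$ of size at most $1$.
   Context: Matroids are identified with their families of independent sets. A matroid is loopless if every singleton is independent. For matroids $\mathcal{M}_1,\dots,\mathcal{M}_k$ on $N$, the union $\mathcal{M}_1\lor\dots\lor\mathcal{M}_k$ is the matroid consisting of all $S$ that can be partitioned into $S_1,\dots,S_k$ with $S_\ell\in\mathcal{M}_\ell$. The $k$-fold union is $\mathcal{U}^k=\bigvee_{i\in[k]}\mathcal{U}$. Secretary problem with feasibility constraint $\mathcal{F}\subseteq 2^N$, $N=[n]$: the elements have distinct nonnegative weights, unknown in advance, while $\mathcal{F}$ is known. The elements arrive one at a time in uniformly random order. On arrival an element's weight is revealed, and it must be irrevocably accepted or rejected, subject to the accepted set always lying in $\mathcal{F}$. $w(S)$ is the total weight of $S$. An algorithm is $\alpha$-competitive if for every weight assignment $\mathbb{E}[w(\mathrm{ALG})]\ge\alpha\cdot\max_{S\in\mathcal{F}}w(S)$. *)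

theory Defs
  imports Complex_Main "HOL-Combinatorics.Multiset_Permutations"
begin

definition matroid_on :: "nat set \<Rightarrow> nat set set \<Rightarrow> bool" where
  "matroid_on N M \<longleftrightarrow> M \<subseteq> Pow N \<and> {} \<in> M
     \<and> (\<forall>A B. A \<in> M \<and> B \<subseteq> A \<longrightarrow> B \<in> M)
     \<and> (\<forall>A B. A \<in> M \<and> B \<in> M \<and> card A < card B \<longrightarrow> (\<exists>x\<in>B - A. insert x A \<in> M))"

definition loopless_on :: "nat set \<Rightarrow> nat set set \<Rightarrow> bool" where
  "loopless_on N M \<longleftrightarrow> (\<forall>x\<in>N. {x} \<in> M)"

definition mat_union :: "nat set set \<Rightarrow> nat set set \<Rightarrow> nat set set" where
  "mat_union M1 M2 = {S. \<exists>A B. A \<inter> B = {} \<and> A \<union> B = S \<and> A \<in> M1 \<and> B \<in> M2}"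

definition uniform1 :: "nat set \<Rightarrow> nat set set" where
  "uniform1 N = {S. S \<subseteq> N \<and> card S \<le> 1}"

text \<open>k-fold union; the 0-fold union is the trivial family {{}}, the unit of union.\<close>
fun union_pow :: "nat set set \<Rightarrow> nat \<Rightarrow> nat set set" where
  "union_pow U 0 = {{}}"
| "union_pow U (Suc k) = mat_union U (union_pow U k)"

text \<open>A (possibly randomized) online algorithm in behavioural form: given the history
  (arrived elements, their weights, and past accept decisions), the current element and
  its weight, it returns the probability of accepting (clamped to [0,1]).
  An attempted acceptance violating feasibility is treated as a rejection.\<close>
type_synonym history = "(nat \<times> real \<times> bool) list"
type_synonym algorithm = "history \<Rightarrow> nat \<Rightarrow> real \<Rightarrow> real"

definition accepted :: "history \<Rightarrow> nat set" where
  "accepted h = {e. \<exists>v. (e, v, True) \<in> set h}"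

fun run :: "nat set set \<Rightarrow> algorithm \<Rightarrow> (nat \<Rightarrow> real) \<Rightarrow> history \<Rightarrow> nat list \<Rightarrow> real" where
  "run F A w h [] = 0"
| "run F A w h (e # es) =
     (let q = (if insert e (accepted h) \<in> F then max 0 (min 1 (A h e (w e))) else 0)
      in q * (w e + run F A w (h @ [(e, w e, True)]) es)
         + (1 - q) * run F A w (h @ [(e, w e, False)]) es)"

definition expected_alg :: "nat set set \<Rightarrow> nat set \<Rightarrow> algorithm \<Rightarrow> (nat \<Rightarrow> real) \<Rightarrow> real" where
  "expected_alg F N A w =
     (\<Sum>\<sigma>\<in>permutations_of_set N. run F A w [] \<sigma>) / real (card (permutations_of_set N))"

definition opt :: "nat set set \<Rightarrow> (nat \<Rightarrow> real) \<Rightarrow> real" where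
  "opt F w = Max ((\<lambda>S. sum w S) ` F)"

definition competitive :: "nat set set \<Rightarrow> nat set \<Rightarrow> real \<Rightarrow> algorithm \<Rightarrow> bool" where
  "competitive F N \<alpha> A \<longleftrightarrow>
     (\<forall>w. inj_on w N \<and> (\<forall>i\<in>N. 0 \<le> w i) \<longrightarrow> expected_alg F N A w \<ge> \<alpha> * opt F w)"

end

theory Submission
  imports Defs "HOL-Analysis.Harmonic_Numbers"
begin

text \<open>
  Let the matroid be a partition matroid with very many parts of equal size \<open>L\<close>, whose elements have
  weights \<open>H ^ z e\<close> with random exponents, independent between parts. Up to the \<open>k\<close> extra
  elements granted by the uniform matroids, which contribute a bounded amount, an algorithm accepts
  at most one element per part, so it plays one independent single-choice secretary problem per part.

  Within a part, the injective exponent vector \<open>z\<close> with maximum \<open>M\<close> gets mass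
  proportional to \<open>H powr - M / (M (M - 1) \<dots> (M - L + 1))\<close>. The factor \<open>H powr - M\<close> makes
  every value of the maximum contribute equally to the optimum, so that for large \<open>H\<close> only the
  probability of hitting the maximum matters. The other factor is a discrete scale-invariant prior:
  after \<open>j\<close> arrivals with maximum \<open>M\<close>, the mass of the event that \<open>M\<close> is the
  overall maximum is \<open>1 / (M (M - 1) \<dots> (M - j + 1))\<close>, and the optimal value of continuing is
  at most \<open>a j\<close> times this, where \<open>a\<close> obeys the recursion of the classical secretary
  problem. The observed values thus give no advantage over relative ranks. As this holds for every
  fixed arrival order, the randomness of the order plays no role.
\<close>

section \<open>Falling factorials and their telescoping sums\<close>

text \<open>The falling factorial. Truncated subtraction makes it 0 for \<open>k > n\<close>, in
  agreement with the number of injections.\<close>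

definition ffact :: "nat \<Rightarrow> nat \<Rightarrow> nat" where
  "ffact n k = (\<Prod>i = 0..<k. n - i)"

lemma ffact_1: "ffact n (Suc 0) = n"
  by (simp add: ffact_def)

lemma ffact_add: "ffact n (j + k) = ffact n j * ffact (n - j) k"
  by (induction k) (simp_all add: ffact_def)

lemma ffact_Suc: "ffact n (Suc k) = ffact n k * (n - k)"
  by (simp add: ffact_def)

lemma ffact_Suc_Suc: "ffact (Suc n) (Suc k) = Suc n * ffact n k"
  using ffact_add[of "Suc n" 1 k] by (simp add: ffact_1)

lemma ffact_pos_iff [simp]: "0 < ffact n k \<longleftrightarrow> k \<le> n"
  by (force simp: ffact_def)

text \<open>By \<open>ffact_add\<close> both sides agree for \<open>k \<le> n\<close>. For
  \<open>n < k\<close> the left side is 0, since its denominator vanishes.\<close>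

lemma ffact_split_le:
  "j \<le> k \<Longrightarrow> real (ffact (n - j) (k - j)) / real (ffact n k) \<le> 1 / real (ffact n j)"
  using ffact_add[of n j "k - j"] by auto

text \<open>\<open>ffact (Suc n) (Suc j)\<close> is both \<open>Suc n\<close> times
  \<open>ffact n j\<close> and \<open>Suc n - j\<close> times \<open>ffact (Suc n) j\<close>; the
  two factorisations yield the two terms on the right.\<close>

lemma ffact_telescope:
  assumes "j \<le> n"
  shows "real j / real (ffact (Suc n) (Suc j)) = 1 / real (ffact n j) - 1 / real (ffact (Suc n) j)"
proof -
  have pos: "0 < ffact n j" "0 < ffact (Suc n) j" "0 < ffact (Suc n) (Suc j)"
    using assms by auto
  have 1: "real (ffact (Suc n) (Suc j)) = real (Suc n) * real (ffact n j)"
    by (simp only: ffact_Suc_Suc of_nat_mult)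
  have 2: "real (ffact (Suc n) (Suc j)) = (real (Suc n) - real j) * real (ffact (Suc n) j)"
    using assms by (simp add: ffact_Suc of_nat_diff)
  have "1 / real (ffact n j) = real (Suc n) / real (ffact (Suc n) (Suc j))"
    unfolding 1 using pos by (simp del: of_nat_Suc)
  moreover have "1 / real (ffact (Suc n) j) = (real (Suc n) - real j) / real (ffact (Suc n) (Suc j))"
    unfolding 2 using pos assms by (simp add: divide_simps)
  ultimately show ?thesis
    by (simp add: diff_divide_distrib)
qed

text \<open>Multiplied by \<open>j\<close>, the sum telescopes, and the term at the upper end is
  dropped. This bounds the mass of all later values that exceed a current maximum
  \<open>n\<close>.\<close>

lemma sum_ffact_tail_le:
  assumes "0 < j" "j \<le> n"
  shows "(\<Sum>y\<in>{n<..r}. 1 / real (ffact y (Suc j))) \<le> 1 / (real j * real (ffact n j))"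
proof (cases "n \<le> r")
  case True
  have "real j * (\<Sum>y\<in>{n<..r}. 1 / real (ffact y (Suc j)))
          = 1 / real (ffact n j) - 1 / real (ffact r j)"
    using True
  proof (induction r rule: dec_induct)
    case base
    then show ?case by simp
  next
    case (step r)
    have "{n<..Suc r} = insert (Suc r) {n<..r}"
      using step.hyps by auto
    then show ?case
      using step ffact_telescope[of j r] assms by (simp add: distrib_left)
  qed
  also have "\<dots> \<le> 1 / real (ffact n j)"
    by simp
  finally show ?thesis
    using assms by (simp add: field_simps)
qed simp

lemma card_inj_PiE:
  assumes "finite A" "finite B"
  shows "card {f \<in> A \<rightarrow>\<^sub>E B. inj_on f A} = ffact (card B) (card A)"
  using card_inj_on_subset_funcset[OF assms order_refl] by (simp add: ffact_def)

subsection \<open>A single part\<close>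

definition inj_configs :: "nat set \<Rightarrow> nat \<Rightarrow> (nat \<Rightarrow> nat) set" where
  "inj_configs E R = {z \<in> E \<rightarrow>\<^sub>E {1..R}. inj_on z E}"

text \<open>The event that the elements of \<open>D\<close> were observed with exponents
  \<open>z0\<close>. Only the values of \<open>z0\<close> on \<open>D\<close> count, so an
  observation is extended by a function update.\<close>

definition cylinder :: "nat set \<Rightarrow> nat \<Rightarrow> nat set \<Rightarrow> (nat \<Rightarrow> nat) \<Rightarrow> (nat \<Rightarrow> nat) set" where
  "cylinder E R D z0 = {z \<in> inj_configs E R. \<forall>d\<in>D. z d = z0 d}"

text \<open>
  Junk value: \<open>ffact n k = 0\<close> for \<open>n < k\<close>, whence the reciprocal is \<open>0\<close>; the
  maximum of an injective vector of positive exponents is never that small.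
\<close>
definition rmass :: "nat set \<Rightarrow> (nat \<Rightarrow> nat) \<Rightarrow> real" where
  "rmass E z = 1 / real (ffact (Max (z ` E)) (card E))"

text \<open>The unnormalised prior. Multiplied by \<open>H\<close> to the maximal exponent it
  becomes \<open>rmass\<close>, so sums of \<open>rmass\<close> are unnormalised expectations of the
  largest weight of the part.\<close>

definition pmass :: "nat set \<Rightarrow> real \<Rightarrow> (nat \<Rightarrow> nat) \<Rightarrow> real" where
  "pmass E H z = rmass E z / H ^ Max (z ` E)"

lemma finite_inj_configs: "finite E \<Longrightarrow> finite (inj_configs E R)"
  unfolding inj_configs_def by (rule finite_subset[of _ "E \<rightarrow>\<^sub>E {1..R}"]) (auto intro: finite_PiE)

lemma finite_cylinder: "finite E \<Longrightarrow> finite (cylinder E R D z0)"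
  unfolding cylinder_def by (simp add: finite_inj_configs)

lemma rmass_nonneg: "0 \<le> rmass E z"
  by (simp add: rmass_def)

lemma card_cylinder_max:
  assumes fin: "finite E" and D: "D \<subseteq> E" "e \<in> D" and inj: "inj_on z0 D"
    and rng: "\<And>d. d \<in> D \<Longrightarrow> 1 \<le> z0 d \<and> z0 d \<le> z0 e" and R: "z0 e \<le> R"
  shows "card {z \<in> cylinder E R D z0. Max (z ` E) = z0 e}
           = ffact (z0 e - card D) (card E - card D)"
proof -
  let ?y = "z0 e"
  let ?B = "{1..?y} - z0 ` D"
  let ?S = "{z \<in> cylinder E R D z0. Max (z ` E) = ?y}"
  let ?T = "{f \<in> (E - D) \<rightarrow>\<^sub>E ?B. inj_on f (E - D)}"
  have finD: "finite D" using fin D finite_subset by blast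
  have "bij_betw (\<lambda>z. restrict z (E - D)) ?S ?T"
  proof (rule bij_betw_byWitness[where f' = "\<lambda>f x. if x \<in> D then z0 x else f x"])
    show "\<forall>z\<in>?S. (\<lambda>x. if x \<in> D then z0 x else restrict z (E - D) x) = z"
      by (auto simp: cylinder_def inj_configs_def fun_eq_iff PiE_def extensional_def)
    show "\<forall>f\<in>?T. restrict (\<lambda>x. if x \<in> D then z0 x else f x) (E - D) = f"
      by (auto simp: fun_eq_iff PiE_def extensional_def)
    show "(\<lambda>z. restrict z (E - D)) ` ?S \<subseteq> ?T"
    proof (clarify, intro conjI)
      fix z assume z: "z \<in> cylinder E R D z0" "Max (z ` E) = ?y"
      have zE: "z \<in> E \<rightarrow>\<^sub>E {1..R}" "inj_on z E" "\<And>d. d \<in> D \<Longrightarrow> z d = z0 d"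
        using z by (auto simp: cylinder_def inj_configs_def)
      have "z x \<in> ?B" if x: "x \<in> E - D" for x
      proof -
        have "z x \<le> Max (z ` E)" using x fin by auto
        moreover have "z x \<noteq> z0 d" if "d \<in> D" for d
          using zE(3)[OF that] inj_onD[OF zE(2), of x d] x that D by auto
        moreover have "1 \<le> z x" using zE x by auto
        ultimately show ?thesis using z by auto
      qed
      then show "restrict z (E - D) \<in> (E - D) \<rightarrow>\<^sub>E ?B" by (simp add: PiE_iff)
      show "inj_on (restrict z (E - D)) (E - D)"
        using zE(2) by (auto simp: inj_on_def)
    qed
    show "(\<lambda>f x. if x \<in> D then z0 x else f x) ` ?T \<subseteq> ?S"
    proof (rule image_subsetI)
      fix f assume "f \<in> ?T"
      then have f: "f \<in> (E - D) \<rightarrow>\<^sub>E ?B" "inj_on f (E - D)" by auto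
      let ?z = "\<lambda>x. if x \<in> D then z0 x else f x"
      have fB: "f x \<in> {1..?y}" "f x \<notin> z0 ` D" if "x \<in> E - D" for x
        using f(1) that PiE_mem by blast+
      have zr: "1 \<le> ?z x \<and> ?z x \<le> ?y" if "x \<in> E" for x
        using rng fB that by auto
      have "?z \<in> E \<rightarrow>\<^sub>E {1..R}"
      proof (rule PiE_I)
        show "?z x \<in> {1..R}" if "x \<in> E" for x using zr[OF that] R by auto
        show "?z x = undefined" if "x \<notin> E" for x
          using that D f(1) by (auto simp: PiE_def extensional_def)
      qed
      moreover have "inj_on ?z E"
      proof (rule inj_onI)
        fix a b assume ab: "a \<in> E" "b \<in> E" "?z a = ?z b"
        show "a = b"
          using ab inj_onD[OF inj, of a b] inj_onD[OF f(2), of a b] fB(2)[of a] fB(2)[of b]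
          by (auto split: if_splits) (metis imageI)+
      qed
      moreover have "Max (?z ` E) = ?y"
      proof (rule Max_eqI)
        show "?y \<in> ?z ` E" by (rule image_eqI[of _ _ e]) (use D in auto)
        show "b \<le> ?y" if "b \<in> ?z ` E" for b using that zr by blast
      qed (use fin in simp)
      ultimately show "?z \<in> ?S"
        by (auto simp: cylinder_def inj_configs_def)
    qed
  qed
  then have "card ?S = card ?T"
    by (rule bij_betw_same_card)
  also have "\<dots> = ffact (card ?B) (card (E - D))"
    by (rule card_inj_PiE) (use fin in auto)
  also have "card ?B = ?y - card D"
    using rng finD card_image[OF inj] by (subst card_Diff_subset) auto
  also have "card (E - D) = card E - card D"
    using finD D by (simp add: card_Diff_subset)
  finally show ?thesis .
qed

text \<open>Conditions on the exponent \<open>y\<close> of the next element \<open>e\<close>;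
  injectivity rules out the values already seen on \<open>D\<close>.\<close>

lemma sum_cylinder_split:
  assumes fin: "finite E" and e: "e \<in> E" "e \<notin> D" and DE: "D \<subseteq> E"
  shows "(\<Sum>z\<in>cylinder E R D z0. f z)
       = (\<Sum>y\<in>{1..R} - z0 ` D. \<Sum>z\<in>cylinder E R (insert e D) (z0(e := y)). f z)"
proof -
  have sub: "(\<lambda>z. z e) ` cylinder E R D z0 \<subseteq> {1..R} - z0 ` D"
  proof (rule image_subsetI)
    fix z assume z: "z \<in> cylinder E R D z0"
    then have zE: "z \<in> E \<rightarrow>\<^sub>E {1..R}" "inj_on z E" "\<And>d. d \<in> D \<Longrightarrow> z d = z0 d"
      by (auto simp: cylinder_def inj_configs_def)
    have "z e \<noteq> z0 d" if "d \<in> D" for d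
      using zE(3)[OF that] inj_onD[OF zE(2), of e d] e that DE by auto
    moreover have "z e \<in> {1..R}" using zE(1) e(1) by auto
    ultimately show "z e \<in> {1..R} - z0 ` D" by auto
  qed
  have eq: "{z \<in> cylinder E R D z0. z e = y} = cylinder E R (insert e D) (z0(e := y))" for y
    using e(2) by (auto simp: cylinder_def)
  show ?thesis
    unfolding eq[symmetric]
    by (rule sum.group[symmetric]) (use fin sub in \<open>auto simp: finite_cylinder\<close>)
qed

text \<open>The value of accepting \<open>e\<close>. If \<open>e\<close> is the overall maximum,
  \<open>H ^ z0 e\<close> turns \<open>pmass\<close> into \<open>rmass\<close>, and counting
  completions gives the first term. Otherwise the maximal exponent exceeds \<open>z0 e\<close> by at
  least 1, which costs a factor \<open>1 / H\<close>.\<close>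

lemma win_mass_le:
  assumes fin: "finite E" and D: "D \<subseteq> E" "e \<in> D" and H: "1 \<le> H"
    and inj: "inj_on z0 D" and rng: "z0 ` D \<subseteq> {1..R}"
  shows "(\<Sum>z\<in>cylinder E R D z0. pmass E H z * H ^ z0 e)
       \<le> (if \<forall>d\<in>D. z0 d \<le> z0 e then 1 / real (ffact (z0 e) (card D)) else 0)
         + (\<Sum>z\<in>cylinder E R D z0. rmass E z) / H"
proof -
  let ?C = "cylinder E R D z0"
  let ?W = "{z \<in> ?C. Max (z ` E) = z0 e}"
  have finC: "finite ?C" using fin by (rule finite_cylinder)
  have pt: "pmass E H z * H ^ z0 e \<le> (if Max (z ` E) = z0 e then rmass E z else 0) + rmass E z / H"
    if z: "z \<in> ?C" for z
  proof (cases "Max (z ` E) = z0 e")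
    case True
    then show ?thesis using H rmass_nonneg[of E z] by (simp add: pmass_def)
  next
    case False
    have "z e = z0 e" using z D by (auto simp: cylinder_def)
    moreover have "z e \<le> Max (z ` E)" using D fin by auto
    ultimately have "Suc (z0 e) \<le> Max (z ` E)" using False by auto
    then have "H ^ Suc (z0 e) \<le> H ^ Max (z ` E)" using H by (rule power_increasing)
    then have "H ^ z0 e / H ^ Max (z ` E) \<le> 1 / H"
      using H by (simp add: field_simps)
    then have "rmass E z * (H ^ z0 e / H ^ Max (z ` E)) \<le> rmass E z * (1 / H)"
      by (rule mult_left_mono) (rule rmass_nonneg)
    then show ?thesis using False by (simp add: pmass_def)
  qed
  have W: "(\<Sum>z\<in>?W. rmass E z)
      \<le> (if \<forall>d\<in>D. z0 d \<le> z0 e then 1 / real (ffact (z0 e) (card D)) else 0)"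
  proof (cases "\<forall>d\<in>D. z0 d \<le> z0 e")
    case True
    have "(\<Sum>z\<in>?W. rmass E z) = real (card ?W) * (1 / real (ffact (z0 e) (card E)))"
      by (simp add: rmass_def)
    also have "card ?W = ffact (z0 e - card D) (card E - card D)"
      by (rule card_cylinder_max) (use fin D inj rng True in auto)
    finally show ?thesis
      using True ffact_split_le[of "card D" "card E" "z0 e"] card_mono[OF fin D(1)] by simp
  next
    case False
    then obtain d where d: "d \<in> D" "z0 e < z0 d" by force
    have "z \<notin> ?W" for z
    proof
      assume "z \<in> ?W"
      then have "z d = z0 d" "Max (z ` E) = z0 e" using d by (auto simp: cylinder_def)
      moreover have "z d \<le> Max (z ` E)" using d D fin by auto
      ultimately show False using d by simp
    qed
    then have "?W = {}" by blast
    then have "(\<Sum>z\<in>?W. rmass E z) = 0" by (simp only: sum.empty)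
    then show ?thesis using False by simp
  qed
  have "(\<Sum>z\<in>?C. pmass E H z * H ^ z0 e)
      \<le> (\<Sum>z\<in>?C. (if Max (z ` E) = z0 e then rmass E z else 0) + rmass E z / H)"
    by (rule sum_mono) (rule pt)
  also have "\<dots> = (\<Sum>z\<in>?W. rmass E z) + (\<Sum>z\<in>?C. rmass E z) / H"
    using finC by (simp add: sum.distrib sum_divide_distrib sum.inter_filter)
  finally show ?thesis using W by linarith
qed

text \<open>
  Bounds the mass won by optimal continuation when the elements of \<open>D\<close> have been observed with
  exponents \<open>z0\<close> and none of them was accepted.
\<close>
definition potential :: "(nat \<Rightarrow> real) \<Rightarrow> nat \<Rightarrow> nat set \<Rightarrow> (nat \<Rightarrow> nat) \<Rightarrow> real" where
  "potential a R D z0 = (if D = {} then max 1 (a 1) * harm R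
     else a (card D) / real (ffact (Max (z0 ` D)) (card D)))"

text \<open>One step of the backward induction. Let \<open>j = card D > 0\<close> with current
  maximum \<open>M\<close>. The \<open>M - j\<close> free values below \<open>M\<close> together
  contribute at most \<open>a (Suc j) / ffact M j\<close>. Values above \<open>M\<close> are
  records, where the better of stopping and continuing has the factor
  \<open>max 1 (a (Suc j))\<close>, and \<open>sum_ffact_tail_le\<close> adds them up. The recursion
  for \<open>a\<close> combines both.\<close>

lemma potential_step:
  assumes fin: "finite D" and e: "e \<notin> D"
    and inj: "inj_on z0 D" and rng: "z0 ` D \<subseteq> {1..R}"
    and a0: "0 \<le> a (Suc (card D))"
    and cert: "D \<noteq> {} \<Longrightarrow> a (Suc (card D)) + max 1 (a (Suc (card D))) / real (card D) \<le> a (card D)"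
  shows "(\<Sum>y\<in>{1..R} - z0 ` D.
            max (if \<forall>d\<in>D. z0 d \<le> y then 1 / real (ffact y (Suc (card D))) else 0)
                (potential a R (insert e D) (z0(e := y)))) \<le> potential a R D z0"
proof (cases "D = {}")
  case True
  \<comment> \<open>With nothing seen yet, every value is a record, which leads to the harmonic
    sum.\<close>
  have "max (1 / real y) (a 1 / real y) = max 1 (a 1) * inverse (real y)" for y
    by (simp add: max_def divide_simps)
  then have "(\<Sum>y = 1..R. max (1 / real y) (a 1 / real y)) = max 1 (a 1) * harm R"
    by (simp add: harm_def sum_distrib_left)
  then show ?thesis
    using True by (simp add: potential_def ffact_1)
next
  case False
  define j where "j = card D"
  define M where "M = Max (z0 ` D)"
  have j: "0 < j" using False fin by (simp add: j_def card_gt_0_iff)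
  have MD: "M \<in> z0 ` D" unfolding M_def using fin False by (intro Max_in) auto
  have leM: "z0 d \<le> M" if "d \<in> D" for d unfolding M_def using fin that by auto
  have sub: "z0 ` D \<subseteq> {1..M}" using rng leM by auto
  have cj: "card (z0 ` D) = j" unfolding j_def by (rule card_image[OF inj])
  have jM: "j \<le> M" using card_mono[OF _ sub] cj by simp
  have MR: "M \<le> R" using MD rng by auto
  let ?f = "\<lambda>y. max (if \<forall>d\<in>D. z0 d \<le> y then 1 / real (ffact y (Suc j)) else 0)
                (potential a R (insert e D) (z0(e := y)))"
  have img: "(z0(e := y)) ` insert e D = insert y (z0 ` D)" for y
    using e by auto
  have pot: "potential a R (insert e D) (z0(e := y)) = a (Suc j) / real (ffact (max y M) (Suc j))" for y
    unfolding potential_def img using e fin False by (simp add: j_def M_def)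
  have eq: "{1..R} - z0 ` D = ({1..M} - z0 ` D) \<union> {M<..R}"
    using MR sub by auto
  have small: "?f y = a (Suc j) / real (ffact M (Suc j))" if "y \<in> {1..M} - z0 ` D" for y
  proof -
    have "y < M" using that MD by (metis DiffD1 DiffD2 atLeastAtMost_iff le_neq_implies_less)
    then have "\<not> (\<forall>d\<in>D. z0 d \<le> y)" using MD by (metis imageE leD)
    then show ?thesis unfolding pot using \<open>y < M\<close> a0 by (auto simp: j_def)
  qed
  have big: "?f y = max 1 (a (Suc j)) * (1 / real (ffact y (Suc j)))" if "y \<in> {M<..R}" for y
  proof -
    have "\<forall>d\<in>D. z0 d \<le> y" using that leM by fastforce
    then show ?thesis unfolding pot using that by (simp add: max_divide_distrib_right)
  qed
  have "(\<Sum>y\<in>{1..R} - z0 ` D. ?f y) = (\<Sum>y\<in>{1..M} - z0 ` D. ?f y) + (\<Sum>y\<in>{M<..R}. ?f y)"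
    unfolding eq by (rule sum.union_disjoint) auto
  also have "(\<Sum>y\<in>{1..M} - z0 ` D. ?f y) = real (card ({1..M} - z0 ` D)) * (a (Suc j) / real (ffact M (Suc j)))"
    using small by simp
  also have "card ({1..M} - z0 ` D) = M - j"
    using sub fin cj by (simp add: card_Diff_subset)
  also have "real (M - j) * (a (Suc j) / real (ffact M (Suc j)))
      = a (Suc j) * (real (ffact (M - j) (Suc j - j)) / real (ffact M (Suc j)))"
    by (simp add: ffact_1 Suc_diff_le)
  also have "\<dots> \<le> a (Suc j) * (1 / real (ffact M j))"
    using a0 by (intro mult_left_mono ffact_split_le) (auto simp: j_def)
  also have "(\<Sum>y\<in>{M<..R}. ?f y) = max 1 (a (Suc j)) * (\<Sum>y\<in>{M<..R}. 1 / real (ffact y (Suc j)))"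
    using big by (simp add: sum_distrib_left)
  also have "\<dots> \<le> max 1 (a (Suc j)) * (1 / (real j * real (ffact M j)))"
    by (intro mult_left_mono sum_ffact_tail_le j jM) auto
  also have "a (Suc j) * (1 / real (ffact M j)) + max 1 (a (Suc j)) * (1 / (real j * real (ffact M j)))
      = (a (Suc j) + max 1 (a (Suc j)) / real j) / real (ffact M j)"
    by (simp add: add_divide_distrib)
  also have "\<dots> \<le> a j / real (ffact M j)"
    using cert False by (intro divide_right_mono) (auto simp: j_def)
  also have "\<dots> = potential a R D z0"
    using False by (simp add: potential_def j_def M_def)
  finally show ?thesis
    by (simp only: j_def)
qed

section \<open>Online runs and the first acceptance in a part\<close>

text \<open>Isolates the probability used inside \<open>run\<close>, so that \<open>first\<close>
  follows the same random decisions.\<close>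

definition acc_prob :: "nat set set \<Rightarrow> algorithm \<Rightarrow> history \<Rightarrow> nat \<Rightarrow> real \<Rightarrow> real" where
  "acc_prob F A h e v = (if insert e (accepted h) \<in> F then max 0 (min 1 (A h e v)) else 0)"

lemma acc_prob_bounds: "0 \<le> acc_prob F A h e v" "acc_prob F A h e v \<le> 1"
  by (auto simp: acc_prob_def)

lemma run_Cons:
  "run F A w h (e # es) = acc_prob F A h e (w e) * (w e + run F A w (h @ [(e, w e, True)]) es)
     + (1 - acc_prob F A h e (w e)) * run F A w (h @ [(e, w e, False)]) es"
  by (simp add: acc_prob_def Let_def)

declare run.simps(2) [simp del]

text \<open>Expected weight of the first accepted element of \<open>E\<close>, counted as 0 if there
  is none. Arrivals outside \<open>E\<close> enter the history as in \<open>run\<close>.\<close>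

fun first :: "nat set set \<Rightarrow> algorithm \<Rightarrow> (nat \<Rightarrow> real) \<Rightarrow> nat set \<Rightarrow> history \<Rightarrow> nat list \<Rightarrow> real" where
  "first F A w E h [] = 0"
| "first F A w E h (e # es) = acc_prob F A h e (w e) *
       (if e \<in> E then w e else first F A w E (h @ [(e, w e, True)]) es)
     + (1 - acc_prob F A h e (w e)) * first F A w E (h @ [(e, w e, False)]) es"

lemma first_cong:
  "(\<And>e. e \<in> set es \<Longrightarrow> w e = w' e) \<Longrightarrow> first F A w E h es = first F A w' E h es"
  by (induction es arbitrary: h) auto

text \<open>A randomised decision is no better than the better pure one; \<open>s\<close> is an
  error term common to both.\<close>

lemma convex_max_le:
  fixes q x y u v s :: real
  assumes "0 \<le> q" "q \<le> 1" "x \<le> u + s" "y \<le> v + s"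
  shows "q * x + (1 - q) * y \<le> max u v + s"
proof -
  have "q * x + (1 - q) * y \<le> q * (max u v + s) + (1 - q) * (max u v + s)"
    using assms by (intro add_mono mult_left_mono) auto
  then show ?thesis by (simp add: algebra_simps)
qed

text \<open>Backward induction over the remaining arrivals. All configurations in a cylinder agree
  on what was observed, so one history \<open>h\<close> serves them all and acceptance probabilities
  factor out. Elements outside \<open>E\<close> have fixed weights \<open>v\<close> and reveal
  nothing about \<open>z\<close>. An element of \<open>E\<close> splits the cylinder: accepting is
  bounded by \<open>win_mass_le\<close>, rejecting by the induction hypothesis, and
  \<open>potential_step\<close> sums over the split.\<close>

lemma sum_first_le:
  fixes H c :: real and v :: "nat \<Rightarrow> real"
  assumes fin: "finite E" and H: "1 \<le> H" and c: "0 \<le> c"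
    and a0: "\<And>j. 0 \<le> a j"
    and cert: "\<And>j. 0 < j \<Longrightarrow> j < card E \<Longrightarrow> a (Suc j) + max 1 (a (Suc j)) / real j \<le> a j"
  defines "W \<equiv> \<lambda>z e. if e \<in> E then c * H ^ z e else v e"
  shows "\<lbrakk>distinct es; D \<subseteq> E; set es \<inter> E = E - D\<rbrakk> \<Longrightarrow>
     (\<Sum>z\<in>cylinder E R D z0. pmass E H z * first F A (W z) E h es)
       \<le> c * (potential a R D z0 + (\<Sum>z\<in>cylinder E R D z0. rmass E z) / H)"
proof (induction es arbitrary: D z0 h)
  case Nil
  have "0 \<le> potential a R D z0"
    by (auto simp: potential_def a0 intro!: mult_nonneg_nonneg harm_nonneg)
  moreover have "0 \<le> (\<Sum>z\<in>cylinder E R D z0. rmass E z) / H"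
    using H by (intro divide_nonneg_nonneg sum_nonneg rmass_nonneg) auto
  ultimately show ?case using c by simp
next
  case (Cons e es)
  show ?case
  proof (cases "e \<in> E")
    case False
    let ?q = "acc_prob F A h e (v e)"
    let ?S = "\<lambda>b. \<Sum>z\<in>cylinder E R D z0. pmass E H z * first F A (W z) E (h @ [(e, v e, b)]) es"
    let ?B = "c * (potential a R D z0 + (\<Sum>z\<in>cylinder E R D z0. rmass E z) / H)"
    have We: "W z e = v e" for z using False by (simp add: W_def)
    have "(\<Sum>z\<in>cylinder E R D z0. pmass E H z * first F A (W z) E h (e # es))
        = (\<Sum>z\<in>cylinder E R D z0. ?q * (pmass E H z * first F A (W z) E (h @ [(e, v e, True)]) es)
            + (1 - ?q) * (pmass E H z * first F A (W z) E (h @ [(e, v e, False)]) es))"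
      using False by (intro sum.cong refl) (simp add: We algebra_simps)
    also have "\<dots> = ?q * ?S True + (1 - ?q) * ?S False"
      by (simp add: sum_distrib_left sum.distrib)
    also have "\<dots> \<le> max ?B ?B + 0"
    proof (rule convex_max_le[OF acc_prob_bounds])
      have S: "?S b \<le> ?B" for b
        using Cons.prems False by (intro Cons.IH) auto
      show "?S True \<le> ?B + 0" "?S False \<le> ?B + 0"
        using S[of True] S[of False] by simp_all
    qed
    finally show ?thesis by simp
  next
    case True
    have e: "e \<notin> D" "D \<subseteq> E" "D \<noteq> E" using Cons.prems True by auto
    have finD: "finite D" using e fin finite_subset by blast
    show ?thesis
    proof (cases "cylinder E R D z0 = {}")
      case empty: True
      have "0 \<le> potential a R D z0"
        by (auto simp: potential_def a0 intro!: mult_nonneg_nonneg harm_nonneg)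
      then show ?thesis using empty c by simp
    next
      case False
      \<comment> \<open>Any member of the cylinder certifies that \<open>z0\<close> is injective on
        \<open>D\<close> with values in range.\<close>
      then obtain z1 where "z1 \<in> cylinder E R D z0" by blast
      then have z1: "z1 \<in> E \<rightarrow>\<^sub>E {1..R}" "inj_on z1 E" "\<And>d. d \<in> D \<Longrightarrow> z1 d = z0 d"
        by (auto simp: cylinder_def inj_configs_def)
      have inj: "inj_on z0 D"
        using inj_on_subset[OF z1(2) e(2)] z1(3) by (simp cong: inj_on_cong)
      have rng: "z0 ` D \<subseteq> {1..R}"
        using z1(1,3) e(2) by (force simp: PiE_def Pi_def)
      let ?C = "\<lambda>y. cylinder E R (insert e D) (z0(e := y))"
      let ?win = "\<lambda>y. if \<forall>d\<in>D. z0 d \<le> y then 1 / real (ffact y (Suc (card D))) else 0"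
      let ?pot = "\<lambda>y. potential a R (insert e D) (z0(e := y))"
      let ?r = "\<lambda>y. (\<Sum>z\<in>?C y. rmass E z) / H"
      have step: "(\<Sum>z\<in>?C y. pmass E H z * first F A (W z) E h (e # es))
          \<le> c * max (?win y) (?pot y) + c * ?r y" if y: "y \<in> {1..R} - z0 ` D" for y
      proof -
        let ?v = "c * H ^ y"
        let ?q = "acc_prob F A h e ?v"
        let ?S = "\<Sum>z\<in>?C y. pmass E H z * first F A (W z) E (h @ [(e, ?v, False)]) es"
        let ?G = "\<Sum>z\<in>?C y. pmass E H z * H ^ y"
        have We: "W z e = ?v" if "z \<in> ?C y" for z
          using that True by (simp add: W_def cylinder_def)
        have "(\<Sum>z\<in>?C y. pmass E H z * first F A (W z) E h (e # es))
            = (\<Sum>z\<in>?C y. ?q * (c * (pmass E H z * H ^ y))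
                + (1 - ?q) * (pmass E H z * first F A (W z) E (h @ [(e, ?v, False)]) es))"
          using True by (intro sum.cong refl) (simp add: We algebra_simps)
        also have "\<dots> = ?q * (c * ?G) + (1 - ?q) * ?S"
          by (simp add: sum_distrib_left sum.distrib)
        also have "\<dots> \<le> max (c * ?win y) (c * ?pot y) + c * ?r y"
        proof (rule convex_max_le[OF acc_prob_bounds])
          have ball: "(\<forall>d\<in>insert e D. (z0(e := y)) d \<le> y) \<longleftrightarrow> (\<forall>d\<in>D. z0 d \<le> y)"
            using e(1) by auto
          have img: "(z0(e := y)) ` insert e D = insert y (z0 ` D)"
            using e(1) by auto
          have inj': "inj_on (z0(e := y)) (insert e D)"
            using inj y e(1) by (auto simp: inj_on_def)
          have rng': "(z0(e := y)) ` insert e D \<subseteq> {1..R}"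
            unfolding img using y rng by auto
          have "?G \<le> ?win y + ?r y"
            using win_mass_le[OF fin _ _ H inj' rng', of e] True e
            unfolding fun_upd_same ball card_insert_disjoint[OF finD e(1)] by blast
          from mult_left_mono[OF this c] show "c * ?G \<le> c * ?win y + c * ?r y"
            by (simp only: distrib_left)
          have "?S \<le> c * (?pot y + ?r y)"
            using Cons.prems True by (intro Cons.IH) auto
          then show "?S \<le> c * ?pot y + c * ?r y"
            by (simp only: distrib_left)
        qed
        also have "max (c * ?win y) (c * ?pot y) = c * max (?win y) (?pot y)"
          using c by (simp only: max_mult_distrib_left if_True)
        finally show ?thesis .
      qed
      have "(\<Sum>z\<in>cylinder E R D z0. pmass E H z * first F A (W z) E h (e # es))
          = (\<Sum>y\<in>{1..R} - z0 ` D. \<Sum>z\<in>?C y. pmass E H z * first F A (W z) E h (e # es))"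
        by (rule sum_cylinder_split[OF fin True e(1,2)])
      also have "\<dots> \<le> (\<Sum>y\<in>{1..R} - z0 ` D. c * max (?win y) (?pot y) + c * ?r y)"
        by (rule sum_mono) (rule step)
      also have "\<dots> = c * (\<Sum>y\<in>{1..R} - z0 ` D. max (?win y) (?pot y))
          + c * (\<Sum>y\<in>{1..R} - z0 ` D. ?r y)"
        by (simp only: sum.distrib sum_distrib_left)
      \<comment> \<open>The error terms of the smaller cylinders add up exactly to that of the whole
        one, so errors do not accumulate over the steps.\<close>
      also have "(\<Sum>y\<in>{1..R} - z0 ` D. ?r y) = (\<Sum>z\<in>cylinder E R D z0. rmass E z) / H"
        by (simp only: sum_divide_distrib [symmetric] sum_cylinder_split[OF fin True e(1,2)])
      also have "c * (\<Sum>y\<in>{1..R} - z0 ` D. max (?win y) (?pot y)) \<le> c * potential a R D z0"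
      proof (rule mult_left_mono[OF potential_step c])
        show "a (Suc (card D)) + max 1 (a (Suc (card D))) / real (card D) \<le> a (card D)" if "D \<noteq> {}"
        proof (rule cert)
          show "0 < card D" using that finD by (simp add: card_gt_0_iff)
          show "card D < card E" using e fin by (simp add: psubset_card_mono psubset_eq)
        qed
      qed (use finD e inj rng a0 in auto)
      finally show ?thesis by (simp add: distrib_left)
    qed
  qed
qed

section \<open>Total mass of a part\<close>

text \<open>Sort the vectors by the element \<open>e\<close> and the value \<open>y\<close> of their
  maximum. With \<open>L = card E\<close>, each pair has mass
  \<open>ffact (y - 1) (L - 1) / ffact y L = 1 / y\<close>, and different pairs are disjoint by
  injectivity.\<close>

lemma sum_rmass_ge:
  assumes fin: "finite E" and ne: "E \<noteq> {}"
  shows "real (card E) * (\<Sum>y = card E..R. 1 / real y) \<le> (\<Sum>z\<in>inj_configs E R. rmass E z)"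
proof -
  let ?T = "\<lambda>p. {z \<in> inj_configs E R. z (fst p) = snd p \<and> Max (z ` E) = snd p}"
  have E0: "0 < card E" using fin ne by (simp add: card_gt_0_iff)
  have one: "(\<Sum>z\<in>?T (e, y). rmass E z) = 1 / real y" if "e \<in> E" "y \<in> {card E..R}" for e y
  proof -
    have y: "0 < y" "y \<le> R" "card E \<le> y" using that E0 by auto
    have eq: "?T (e, y) = {z \<in> cylinder E R {e} (\<lambda>_. y). Max (z ` E) = (\<lambda>_. y) e}"
      by (auto simp: cylinder_def)
    have c: "card (?T (e, y)) = ffact (y - 1) (card E - 1)"
      unfolding eq by (subst card_cylinder_max[OF fin]) (use that y in auto)
    have "(\<Sum>z\<in>?T (e, y). rmass E z) = real (card (?T (e, y))) * (1 / real (ffact y (card E)))"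
      by (simp add: rmass_def)
    also have "ffact y (card E) = y * ffact (y - 1) (card E - 1)"
      using ffact_Suc_Suc[of "y - 1" "card E - 1"] E0 y by simp
    finally show ?thesis
      using c y ffact_pos_iff[of "y - 1" "card E - 1"] by (simp del: ffact_pos_iff)
  qed
  have "real (card E) * (\<Sum>y = card E..R. 1 / real y) = (\<Sum>e\<in>E. \<Sum>y = card E..R. 1 / real y)"
    by simp
  also have "\<dots> = (\<Sum>e\<in>E. \<Sum>y = card E..R. \<Sum>z\<in>?T (e, y). rmass E z)"
    by (intro sum.cong refl one [symmetric])
  also have "\<dots> = (\<Sum>p\<in>E \<times> {card E..R}. \<Sum>z\<in>?T p. rmass E z)"
    by (simp only: sum.cartesian_product')
  also have "\<dots> = (\<Sum>z\<in>(\<Union>p\<in>E \<times> {card E..R}. ?T p). rmass E z)"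
  proof (rule sum.UNION_disjoint [symmetric])
    show "\<forall>p\<in>E \<times> {card E..R}. \<forall>p'\<in>E \<times> {card E..R}. p \<noteq> p' \<longrightarrow> ?T p \<inter> ?T p' = {}"
    proof (intro ballI impI equals0I)
      fix p p' z assume p: "p \<in> E \<times> {card E..R}" "p' \<in> E \<times> {card E..R}" "p \<noteq> p'" "z \<in> ?T p \<inter> ?T p'"
      then have "inj_on z E" "z (fst p) = z (fst p')" "snd p = snd p'"
        by (auto simp: inj_configs_def)
      with p show False by (auto dest: inj_onD)
    qed
  qed (use fin in \<open>auto simp: finite_inj_configs\<close>)
  also have "\<dots> \<le> (\<Sum>z\<in>inj_configs E R. rmass E z)"
    by (rule sum_mono2) (use fin in \<open>auto simp: finite_inj_configs rmass_nonneg\<close>)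
  finally show ?thesis .
qed

section \<open>The recursion of the secretary problem\<close>

lemma inverse_le_ln_diff:
  assumes "0 < n"
  shows "1 / real (Suc n) \<le> ln (real (Suc n)) - ln (real n)"
proof -
  have "ln (real n / real (Suc n)) \<le> real n / real (Suc n) - 1"
    using assms by (intro ln_le_minus_one) auto
  also have "\<dots> = - (1 / real (Suc n))"
    by (simp add: field_simps)
  finally show ?thesis
    using assms by (simp add: ln_div)
qed

lemma sum_inverse_le_ln:
  assumes "0 < r" "r \<le> n"
  shows "(\<Sum>i\<in>{r<..n}. 1 / real i) \<le> ln (real n) - ln (real r)"
  using assms(2)
proof (induction n rule: dec_induct)
  case (step n)
  have "{r<..Suc n} = insert (Suc n) {r<..n}"
    using step.hyps by auto
  then show ?case
    using step inverse_le_ln_diff[of n] assms(1) by simp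
qed simp

text \<open>
  The backward recursion of the secretary problem with threshold \<open>r\<close>, where \<open>L\<close> is the least
  integer above \<open>exp 1 * r\<close>.
\<close>
lemma stopping_certificate:
  fixes \<epsilon> :: real
  assumes "0 < \<epsilon>"
  obtains L :: nat and a :: "nat \<Rightarrow> real" where "0 < L" "\<And>j. 0 \<le> a j"
    "\<And>j. 0 < j \<Longrightarrow> j < L \<Longrightarrow> a (Suc j) + max 1 (a (Suc j)) / real j \<le> a j"
    "max 1 (a 1) \<le> (1 / exp 1 + \<epsilon>) * real L"
proof -
  obtain r0 :: nat where r0: "1 / \<epsilon> < real r0" using reals_Archimedean2 by blast
  \<comment> \<open>\<open>1 / \<epsilon> < r\<close> absorbs an additive 1 at the end, and
    \<open>2 \<le> r\<close> puts index 1 below the threshold.\<close>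
  define r where "r = r0 + 2"
  define L where "L = nat \<lfloor>exp 1 * real r\<rfloor> + 1"
  define s where "s = (\<lambda>j. \<Sum>i = j..<L. 1 / real i)"
  \<comment> \<open>\<open>s r\<close> may slightly exceed 1, but \<open>K\<close> stays at most
    \<open>1 + 1 / r\<close>.\<close>
  define K where "K = max 1 (s r)"
  \<comment> \<open>From the threshold on, the maximum in the recursion is 1 and reciprocals add up.
    Where \<open>a (Suc j) \<ge> 1\<close>, the recursion multiplies by \<open>Suc j / j\<close>,
    which a constant over \<open>j\<close> solves.\<close>
  define a where "a = (\<lambda>j. if j < r then real r * K / real j else s j)"
  have r: "2 \<le> r" by (simp add: r_def)
  have Lr: "exp 1 * real r \<le> real L" "real (L - 1) \<le> exp 1 * real r"
    unfolding L_def by (auto simp: of_nat_floor) linarith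
  have "(1::real) * real r \<le> exp 1 * real r" by (intro mult_right_mono) auto
  then have rL: "r \<le> L - 1" unfolding L_def by (simp add: le_nat_floor)
  have s_rec: "s j = 1 / real j + s (Suc j)" if "j < L" for j
    unfolding s_def using that by (simp add: sum.atLeast_Suc_lessThan)
  have s0: "0 \<le> s j" for j unfolding s_def by (intro sum_nonneg) auto
  \<comment> \<open>The choice of \<open>L\<close> enters here:
    \<open>L - 1 \<le> exp 1 * r\<close>, so comparison with the logarithm gives at most
    \<open>ln (exp 1)\<close>.\<close>
  have s1: "s (Suc r) \<le> 1"
  proof -
    have "s (Suc r) = (\<Sum>i\<in>{r<..L - 1}. 1 / real i)"
      unfolding s_def using rL by (intro sum.cong) (auto simp: L_def)
    also have "\<dots> \<le> ln (real (L - 1)) - ln (real r)"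
      using r rL by (intro sum_inverse_le_ln) auto
    also have "ln (real (L - 1)) \<le> ln (exp 1 * real r)"
      using r rL Lr by (intro ln_mono) auto
    also have "\<dots> = 1 + ln (real r)" using r by (simp add: ln_mult)
    finally show ?thesis by simp
  qed
  have s_le1: "s (Suc j) \<le> 1" if "r \<le> j" for j
  proof -
    have "s (Suc j) \<le> s (Suc r)" unfolding s_def using that by (intro sum_mono2) auto
    then show ?thesis using s1 by simp
  qed
  have K1: "1 \<le> K" by (simp add: K_def)
  have K: "K \<le> 1 + 1 / real r" using s_rec[of r] s1 rL r by (simp add: K_def)
  show thesis
  proof
    show "0 < L" by (simp add: L_def)
    show "0 \<le> a j" for j using K1 s0 by (simp add: a_def)
    show "a (Suc j) + max 1 (a (Suc j)) / real j \<le> a j" if j: "0 < j" "j < L" for j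
    proof -
      consider "r \<le> j" | "Suc j = r" | "Suc j < r" by linarith
      then show ?thesis
      proof cases
        case 1
        then show ?thesis using s_le1[OF 1] s_rec[OF j(2)] by (simp add: a_def max_def)
      next
        case 2
        \<comment> \<open>The junction of the two formulas: \<open>a (Suc j)\<close> is
          \<open>s r\<close>, and bounding it by \<open>K\<close> continues the lower one.\<close>
        have "a (Suc j) \<le> K" "max 1 (a (Suc j)) = K" using 2 by (auto simp: a_def K_def)
        then have "a (Suc j) + max 1 (a (Suc j)) / real j \<le> K + K / real j" by simp
        also have "\<dots> = real (Suc j) * K / real j" using j by (simp add: field_simps)
        finally show ?thesis using 2 by (simp add: a_def)
      next
        case 3
        have "1 * real (Suc j) \<le> K * real r" using 3 K1 by (intro mult_mono) auto
        then have "1 \<le> a (Suc j)" using 3 by (simp add: a_def field_simps)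
        then have "a (Suc j) + max 1 (a (Suc j)) / real j = a (Suc j) * (real (Suc j) / real j)"
          using j by (simp add: field_simps)
        also have "\<dots> = a j" using 3 j by (simp add: a_def)
        finally show ?thesis by simp
      qed
    qed
    have "real r * K \<le> real r * (1 + 1 / real r)" using K by (intro mult_left_mono) auto
    then have rK: "real r * K \<le> real r + 1" using r by (simp add: distrib_left)
    have "max 1 (a 1) \<le> real r + 1" using rK r by (simp add: a_def)
    also have "\<dots> \<le> real r + \<epsilon> * real r"
      using r0 assms by (simp add: r_def field_simps)
    also have "\<dots> \<le> real r + \<epsilon> * real L"
      using rL assms by simp
    also have "real r \<le> real L / exp 1"
      using Lr(1) by (simp add: field_simps)
    finally show "max 1 (a 1) \<le> (1 / exp 1 + \<epsilon>) * real L" by (simp add: field_simps)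
  qed
qed

section \<open>Choice of the parameters of a part\<close>

text \<open>With nothing observed, the potential is at most about \<open>L / exp 1 * harm R\<close>,
  while the total \<open>rmass\<close> is at least \<open>L\<close> times \<open>harm R\<close>
  without its first \<open>L - 1\<close> terms; for large \<open>R\<close> these terms are
  negligible. \<open>L\<close>, \<open>R\<close> and \<open>H\<close> depend on
  \<open>\<epsilon>\<close> only, hence are fixed before the algorithm.\<close>

lemma single_part_hardness:
  fixes \<epsilon> :: real
  assumes "0 < \<epsilon>"
  obtains L R :: nat and H :: real where "0 < L" "2 \<le> H"
    "\<And>E. \<lbrakk>finite E; card E = L\<rbrakk> \<Longrightarrow> 0 < (\<Sum>z\<in>inj_configs E R. pmass E H z)"
    "\<And>E F A c v h es. \<lbrakk>finite E; card E = L; 0 \<le> c; distinct es; E \<subseteq> set es\<rbrakk> \<Longrightarrow>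
       (\<Sum>z\<in>inj_configs E R. pmass E H z * first F A (\<lambda>e. if e \<in> E then c * H ^ z e else v e) E h es)
         \<le> c * ((1 / exp 1 + \<epsilon>) * (\<Sum>z\<in>inj_configs E R. rmass E z))"
proof -
  \<comment> \<open>One third each for the stopping recursion, the first \<open>L - 1\<close>
    harmonic terms and the error \<open>1 / H\<close>.\<close>
  define \<delta> where "\<delta> = \<epsilon> / 3"
  have \<delta>: "0 < \<delta>" using assms by (simp add: \<delta>_def)
  obtain L a where L: "0 < L" and a0: "\<And>j. 0 \<le> a j"
    and cert: "\<And>j. 0 < j \<Longrightarrow> j < L \<Longrightarrow> a (Suc j) + max 1 (a (Suc j)) / real j \<le> a j"
    and a1: "max 1 (a 1) \<le> (1 / exp 1 + \<delta>) * real L"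
    using stopping_certificate[OF \<delta>] by metis
  \<comment> \<open>\<open>1 / \<delta>\<close> controls the error \<open>1 / H\<close>; the bound 2
    later keeps scaled powers of \<open>H\<close> distinct.\<close>
  define H where "H = max 2 (1 / \<delta>)"
  have H: "2 \<le> H" "1 \<le> H" by (auto simp: H_def)
  have "1 / \<delta> \<le> H" by (simp add: H_def)
  then have H\<delta>: "1 / H \<le> \<delta>" using \<delta> H by (simp add: field_simps)
  \<comment> \<open>Once \<open>S\<close> reaches \<open>b\<close>, the harmonic terms below
    \<open>L\<close> cost at most \<open>\<delta> * L * S\<close>.\<close>
  define b where "b = max 1 (a 1) * harm (L - 1) / (\<delta> * real L)"
  have "filterlim (harm :: nat \<Rightarrow> real) at_top sequentially" by (rule harm_at_top)
  then have "eventually (\<lambda>R. b + harm (L - 1) + 1 \<le> harm R) sequentially"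
    by (simp add: filterlim_at_top)
  with eventually_ge_at_top[of L] obtain R where R: "L \<le> R" "b + harm (L - 1) + 1 \<le> harm R"
    using eventually_happens'[OF sequentially_bot eventually_conj] by blast
  define S where "S = (\<Sum>y = L..R. 1 / real y)"
  have "{1..R} = {1..L - 1} \<union> {L..R}" using R L by auto
  then have "harm R = harm (L - 1) + S"
    unfolding harm_def S_def by (simp add: sum.union_disjoint inverse_eq_divide)
  then have harmR: "harm R = harm (L - 1) + S" by simp
  have b0: "0 \<le> b" unfolding b_def using \<delta> by (intro divide_nonneg_nonneg mult_nonneg_nonneg harm_nonneg) auto
  have S: "b \<le> S" "0 < S" using R(2) harmR b0 by auto
  have bS: "max 1 (a 1) * harm (L - 1) \<le> \<delta> * (real L * S)"
    using S(1) \<delta> L unfolding b_def by (simp add: field_simps)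
  have mass: "real L * S \<le> (\<Sum>z\<in>inj_configs E R. rmass E z)" if "finite E" "card E = L" for E
    using sum_rmass_ge[OF that(1), of R] that L unfolding S_def by fastforce
  show thesis
  proof
    show "0 < L" "2 \<le> H" by fact+
    show "0 < (\<Sum>z\<in>inj_configs E R. pmass E H z)" if E: "finite E" "card E = L" for E
    proof -
      have E0: "E \<noteq> {}" using E L by auto
      \<comment> \<open>Exponents are at most \<open>R\<close>, so \<open>pmass\<close> is at least
        \<open>rmass / H ^ R\<close>; positivity allows the prior to be normalised.\<close>
      have "0 < (\<Sum>z\<in>inj_configs E R. rmass E z) / H ^ R"
        using less_le_trans[OF _ mass[OF E]] L S H by (intro divide_pos_pos) simp_all
      also have "\<dots> \<le> (\<Sum>z\<in>inj_configs E R. pmass E H z)"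
        unfolding sum_divide_distrib
      proof (rule sum_mono)
        fix z assume "z \<in> inj_configs E R"
        then have "Max (z ` E) \<le> R"
          using E E0 by (auto simp: inj_configs_def)
        then have "H ^ Max (z ` E) \<le> H ^ R" using H by (intro power_increasing)
        then show "rmass E z / H ^ R \<le> pmass E H z"
          unfolding pmass_def using H by (intro divide_left_mono rmass_nonneg) auto
      qed
      finally show ?thesis .
    qed
    fix E :: "nat set" and F :: "nat set set" and A :: algorithm and c :: real
      and v :: "nat \<Rightarrow> real" and h :: history and es :: "nat list"
    assume E: "finite E" "card E = L" and c: "0 \<le> c" and es: "distinct es" "E \<subseteq> set es"
    let ?Z = "\<Sum>z\<in>inj_configs E R. rmass E z"
    have cyl: "cylinder E R {} (\<lambda>_. 0) = inj_configs E R" by (simp add: cylinder_def)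
    have "(\<Sum>z\<in>inj_configs E R. pmass E H z * first F A (\<lambda>e. if e \<in> E then c * H ^ z e else v e) E h es)
        \<le> c * (potential a R {} (\<lambda>_. 0) + ?Z / H)"
      using sum_first_le[where D = "{}" and ?z0.0 = "\<lambda>_. 0" and R = R and F = F and A = A and v = v and h = h,
          OF E(1) H(2) c a0 cert[folded E(2)] es(1)] es(2)
      unfolding cyl by (simp add: Int_absorb1)
    also have "\<dots> \<le> c * ((1 / exp 1 + \<epsilon>) * ?Z)"
    proof (rule mult_left_mono[OF _ c])
      have "potential a R {} (\<lambda>_. 0) = max 1 (a 1) * harm (L - 1) + max 1 (a 1) * S"
        by (simp add: potential_def harmR distrib_left)
      also have "\<dots> \<le> \<delta> * (real L * S) + (1 / exp 1 + \<delta>) * real L * S"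
        using bS a1 S(2) by (intro add_mono mult_right_mono) auto
      also have "\<dots> = (1 / exp 1 + 2 * \<delta>) * (real L * S)" by (simp add: algebra_simps)
      also have "\<dots> \<le> (1 / exp 1 + 2 * \<delta>) * ?Z"
        using mass[OF E] \<delta> by (intro mult_left_mono) auto
      finally have 1: "potential a R {} (\<lambda>_. 0) \<le> (1 / exp 1 + 2 * \<delta>) * ?Z" .
      have "?Z * (1 / H) \<le> ?Z * \<delta>"
        using H\<delta> by (intro mult_left_mono sum_nonneg rmass_nonneg)
      with 1 have "potential a R {} (\<lambda>_. 0) + ?Z / H \<le> (1 / exp 1 + 2 * \<delta>) * ?Z + ?Z * \<delta>"
        by simp
      also have "\<dots> = (1 / exp 1 + \<epsilon>) * ?Z" by (simp add: \<delta>_def algebra_simps)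
      finally show "potential a R {} (\<lambda>_. 0) + ?Z / H \<le> (1 / exp 1 + \<epsilon>) * ?Z" .
    qed
    finally show "(\<Sum>z\<in>inj_configs E R. pmass E H z * first F A (\<lambda>e. if e \<in> E then c * H ^ z e else v e) E h es)
         \<le> c * ((1 / exp 1 + \<epsilon>) * ?Z)" .
  qed
qed

subsection \<open>Combining the parts\<close>

lemma accepted_snoc [simp]:
  "accepted (h @ [(e, v, True)]) = insert e (accepted h)"
  "accepted (h @ [(e, v, False)]) = accepted h"
  by (auto simp: accepted_def)

lemma accepted_Nil [simp]: "accepted [] = {}"
  by (simp add: accepted_def)

text \<open>An accepted element is either the first of its part, paid for by \<open>first\<close>,
  or one of at most \<open>k\<close> extras, each worth at most \<open>B\<close>. The factor of
  \<open>B\<close> counts the extras still available after \<open>h\<close>; parts already hit are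
  left out of the sum.\<close>

lemma run_le_sum_first:
  fixes prt :: "nat \<Rightarrow> nat" and B :: real
  assumes F: "\<And>S. S \<in> F \<Longrightarrow> finite S \<and> card S \<le> card (prt ` S) + k"
    and I: "finite I" and N: "prt ` N \<subseteq> I"
    and w: "\<And>e. e \<in> N \<Longrightarrow> w e \<le> B" and B: "0 \<le> B"
  shows "\<lbrakk>distinct es; set es \<subseteq> N; accepted h \<inter> set es = {}; finite (accepted h);
           card (accepted h) \<le> card (prt ` accepted h) + k\<rbrakk> \<Longrightarrow>
     run F A w h es \<le> (\<Sum>i\<in>I - prt ` accepted h. first F A w {e \<in> N. prt e = i} h es)
       + (real k + real (card (prt ` accepted h)) - real (card (accepted h))) * B"
proof (induction es arbitrary: h)
  case Nil
  then show ?case using B by simp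
next
  case (Cons e es)
  let ?q = "acc_prob F A h e (w e)"
  let ?hT = "h @ [(e, w e, True)]" and ?hF = "h @ [(e, w e, False)]"
  let ?J = "I - prt ` accepted h"
  let ?f = "\<lambda>i h. first F A w {e \<in> N. prt e = i} h es"
  let ?s = "real k + real (card (prt ` accepted h)) - real (card (accepted h))"
  have q: "0 \<le> ?q" "0 \<le> 1 - ?q" by (simp_all add: acc_prob_bounds)
  have e: "e \<in> N" "prt e \<in> I" "e \<notin> accepted h" using Cons.prems N by auto
  have rej: "run F A w ?hF es \<le> (\<Sum>i\<in>?J. ?f i ?hF) + ?s * B"
    using Cons.IH[of ?hF] Cons.prems by simp
  \<comment> \<open>The factor \<open>?q\<close> is kept because it vanishes when the acceptance is
    infeasible.\<close>
  have acc: "?q * (w e + run F A w ?hT es)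
      \<le> ?q * ((\<Sum>i\<in>?J. if prt e = i then w e else ?f i ?hT) + ?s * B)"
  proof (cases "insert e (accepted h) \<in> F")
    case False
    then show ?thesis by (simp add: acc_prob_def)
  next
    case True
    have IH: "run F A w ?hT es \<le> (\<Sum>i\<in>I - insert (prt e) (prt ` accepted h). ?f i ?hT)
        + (real k + real (card (insert (prt e) (prt ` accepted h))) - real (Suc (card (accepted h)))) * B"
      using Cons.IH[of ?hT] Cons.prems e F[OF True] by auto
    have fin: "finite (prt ` accepted h)" using Cons.prems by simp
    have "w e + run F A w ?hT es \<le> (\<Sum>i\<in>?J. if prt e = i then w e else ?f i ?hT) + ?s * B"
    proof (cases "prt e \<in> prt ` accepted h")
      \<comment> \<open>A part hit before: one extra is used up, and its \<open>B\<close> pays for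
        \<open>w e\<close>.\<close>
      case in_acc: True
      have "(\<Sum>i\<in>?J. if prt e = i then w e else ?f i ?hT) = (\<Sum>i\<in>?J. ?f i ?hT)"
        using in_acc by (intro sum.cong) auto
      moreover have "run F A w ?hT es \<le> (\<Sum>i\<in>?J. ?f i ?hT) + (?s - 1) * B"
        using IH in_acc by (simp add: insert_absorb algebra_simps)
      ultimately show ?thesis using w[OF e(1)] by (simp add: algebra_simps)
    next
      \<comment> \<open>A new part: the number of extras is unchanged, and \<open>w e\<close> is the
        term of this part.\<close>
      case False
      have J: "?J = insert (prt e) (I - insert (prt e) (prt ` accepted h))"
        using e(2) False by auto
      have "(\<Sum>i\<in>?J. if prt e = i then w e else ?f i ?hT)
          = w e + (\<Sum>i\<in>I - insert (prt e) (prt ` accepted h). if prt e = i then w e else ?f i ?hT)"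
        unfolding J using I by (subst sum.insert) auto
      also have "\<dots> = w e + (\<Sum>i\<in>I - insert (prt e) (prt ` accepted h). ?f i ?hT)"
        by (intro arg_cong2[where f = "(+)"] refl sum.cong) auto
      finally show ?thesis using IH False fin by (simp add: algebra_simps)
    qed
    then show ?thesis by (rule mult_left_mono[OF _ q(1)])
  qed
  have "run F A w h (e # es) = ?q * (w e + run F A w ?hT es) + (1 - ?q) * run F A w ?hF es"
    by (rule run_Cons)
  also have "\<dots> \<le> ?q * ((\<Sum>i\<in>?J. if prt e = i then w e else ?f i ?hT) + ?s * B)
      + (1 - ?q) * ((\<Sum>i\<in>?J. ?f i ?hF) + ?s * B)"
    by (intro add_mono acc mult_left_mono[OF rej q(2)])
  also have "\<dots> = ?q * (\<Sum>i\<in>?J. if prt e = i then w e else ?f i ?hT)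
      + (1 - ?q) * (\<Sum>i\<in>?J. ?f i ?hF) + ?s * B"
    by (simp add: algebra_simps)
  also have "?q * (\<Sum>i\<in>?J. if prt e = i then w e else ?f i ?hT) + (1 - ?q) * (\<Sum>i\<in>?J. ?f i ?hF)
      = (\<Sum>i\<in>?J. first F A w {e \<in> N. prt e = i} h (e # es))"
    using e(1) by (simp add: sum_distrib_left sum.distrib [symmetric])
  finally show ?case .
qed

section \<open>Partition matroids and their unions with uniform matroids\<close>

text \<open>Independent sets are partial transversals of the parts. The larger of two meets more
  parts, hence one that the smaller misses, which gives the exchange property.\<close>

lemma partition_matroid:
  fixes prt :: "nat \<Rightarrow> nat"
  assumes "finite N"
  defines "M \<equiv> {S. S \<subseteq> N \<and> inj_on prt S}"
  shows "matroid_on N M" "loopless_on N M"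
proof -
  have "\<exists>x\<in>B - A. insert x A \<in> M" if AB: "A \<in> M" "B \<in> M" "card A < card B" for A B
  proof -
    have inj: "A \<subseteq> N" "B \<subseteq> N" "inj_on prt A" "inj_on prt B" using AB by (auto simp: M_def)
    have "card (prt ` A) < card (prt ` B)" using inj AB(3) by (simp add: card_image)
    moreover have "finite (prt ` A)" using inj assms(1) finite_subset by blast
    ultimately have "\<not> prt ` B \<subseteq> prt ` A" by (meson card_mono leD)
    then obtain x where x: "x \<in> B" "prt x \<notin> prt ` A" by auto
    then have "insert x A \<in> M" using inj by (auto simp: M_def)
    then show ?thesis using x by auto
  qed
  then show "matroid_on N M"
    unfolding matroid_on_def by (auto simp: M_def dest: inj_on_subset)
  show "loopless_on N M"
    by (auto simp: loopless_on_def M_def)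
qed

lemma empty_in_union_pow: "{} \<in> union_pow (uniform1 N) k"
  by (induction k) (auto simp: mat_union_def uniform1_def intro: exI[of _ "{}"])

lemma union_pow_uniform1:
  "S \<in> union_pow (uniform1 N) k \<Longrightarrow> S \<subseteq> N \<and> card S \<le> k"
proof (induction k arbitrary: S)
  case (Suc k)
  then obtain X Y where S: "S = X \<union> Y" "X \<in> uniform1 N" "Y \<in> union_pow (uniform1 N) k"
    by (auto simp: mat_union_def)
  with Suc.IH[OF S(3)] card_Un_le[of X Y] show ?case
    by (auto simp: uniform1_def)
qed simp

lemma partition_union_bounds:
  fixes prt :: "nat \<Rightarrow> nat"
  assumes fin: "finite N" and S: "S \<in> mat_union {S. S \<subseteq> N \<and> inj_on prt S} (union_pow (uniform1 N) k)"
  shows "S \<subseteq> N" "card S \<le> card (prt ` S) + k"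
proof -
  obtain X Y where XY: "S = X \<union> Y" "X \<subseteq> N" "inj_on prt X" "Y \<in> union_pow (uniform1 N) k"
    using S by (auto simp: mat_union_def)
  show "S \<subseteq> N" using XY union_pow_uniform1[OF XY(4)] by auto
  then have "card (prt ` X) \<le> card (prt ` S)"
    using XY fin by (intro card_mono) (auto intro: finite_subset)
  moreover have "card X = card (prt ` X)" using XY(3) by (simp add: card_image)
  ultimately show "card S \<le> card (prt ` S) + k"
    using card_Un_le[of X Y, folded XY(1)] union_pow_uniform1[OF XY(4)] by linarith
qed

section \<open>Independent parts and distinct weights\<close>

text \<open>Fixes all coordinates except \<open>i\<close>, averages over that one first and then
  over the others. This reduces the product prior to a single part.\<close>

lemma product_expectation_le:
  fixes p :: "'i \<Rightarrow> 'c \<Rightarrow> real"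
  assumes I: "finite I" "i \<in> I" and C: "\<And>l. l \<in> I \<Longrightarrow> finite (C l)"
    and p0: "\<And>l c. l \<in> I \<Longrightarrow> c \<in> C l \<Longrightarrow> 0 \<le> p l c"
    and p1: "\<And>l. l \<in> I \<Longrightarrow> (\<Sum>c\<in>C l. p l c) = 1"
    and f: "\<And>x. (\<Sum>c\<in>C i. p i c * f (x(i := c))) \<le> b"
  shows "(\<Sum>x\<in>Pi\<^sub>E I C. (\<Prod>l\<in>I. p l (x l)) * f x) \<le> b"
proof -
  define J where "J = I - {i}"
  have J: "I = insert i J" "i \<notin> J" "finite J" using I by (auto simp: J_def)
  have "(\<Sum>x\<in>Pi\<^sub>E I C. (\<Prod>l\<in>I. p l (x l)) * f x)
      = (\<Sum>(c, g)\<in>C i \<times> Pi\<^sub>E J C. (\<Prod>l\<in>I. p l ((g(i := c)) l)) * f (g(i := c)))"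
    unfolding J(1) PiE_insert_eq
    by (subst sum.reindex[OF inj_combinator[OF J(2)]]) (simp add: case_prod_unfold)
  also have "\<dots> = (\<Sum>(c, g)\<in>C i \<times> Pi\<^sub>E J C. p i c * (\<Prod>l\<in>J. p l (g l)) * f (g(i := c)))"
  proof -
    have "(\<Prod>l\<in>I. p l ((g(i := c)) l)) = p i c * (\<Prod>l\<in>J. p l (g l))" for g c
    proof -
      have "(\<Prod>l\<in>J. p l ((g(i := c)) l)) = (\<Prod>l\<in>J. p l (g l))"
        using J(2) by (intro prod.cong) auto
      then show ?thesis using J by simp
    qed
    then show ?thesis by simp
  qed
  also have "\<dots> = (\<Sum>g\<in>Pi\<^sub>E J C. (\<Prod>l\<in>J. p l (g l)) * (\<Sum>c\<in>C i. p i c * f (g(i := c))))"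
    unfolding sum.cartesian_product [symmetric]
    by (subst sum.swap) (simp add: sum_distrib_left mult_ac)
  also have "\<dots> \<le> (\<Sum>g\<in>Pi\<^sub>E J C. (\<Prod>l\<in>J. p l (g l)) * b)"
    using f p0 J(1) by (intro sum_mono mult_left_mono prod_nonneg) (auto simp: PiE_mem)
  also have "\<dots> = (\<Prod>l\<in>J. \<Sum>c\<in>C l. p l c) * b"
    using C J by (subst prod_sum_PiE) (auto simp: sum_distrib_right)
  also have "(\<Prod>l\<in>J. \<Sum>c\<in>C l. p l c) = 1"
    using p1 J(1) by (intro prod.neutral) auto
  finally show ?thesis by simp
qed

text \<open>One element per part is independent in the partition matroid alone; the uniform matroids
  contribute the empty set.\<close>

lemma sum_transversal_le_opt:
  fixes prt :: "nat \<Rightarrow> nat"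
  assumes N: "finite N" and I: "finite I"
    and g: "\<And>i. i \<in> I \<Longrightarrow> g i \<in> N \<and> prt (g i) = i"
  shows "(\<Sum>i\<in>I. w (g i))
      \<le> opt (mat_union {S. S \<subseteq> N \<and> inj_on prt S} (union_pow (uniform1 N) k)) w"
proof -
  let ?F = "mat_union {S. S \<subseteq> N \<and> inj_on prt S} (union_pow (uniform1 N) k)"
  have "inj_on prt (g ` I)" "g ` I \<subseteq> N" using g by (auto simp: inj_on_def)
  then have "g ` I \<in> ?F"
    unfolding mat_union_def
    by (intro CollectI exI[of _ "g ` I"] exI[of _ "{}"]) (simp add: empty_in_union_pow)
  moreover have "finite ?F"
    by (rule finite_subset[of _ "Pow N"]) (use N partition_union_bounds(1)[OF N] in auto)
  ultimately have "sum w (g ` I) \<le> opt ?F w"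
    unfolding opt_def by (intro Max_ge) auto
  moreover have "inj_on g I" by (rule inj_on_inverseI[of _ prt]) (use g in auto)
  ultimately show ?thesis by (simp add: sum.reindex)
qed

text \<open>Factors in \<open>[1, 2)\<close> cannot bridge the ratio of at least 2 between different
  powers of \<open>H\<close>.\<close>

lemma scaled_powers_inj:
  fixes H :: real
  assumes H: "2 \<le> H" and c: "1 \<le> c" "c < 2" "1 \<le> d" "d < 2" and eq: "c * H ^ a = d * H ^ b"
  shows "a = b \<and> c = d"
proof -
  have lt: "c' * H ^ x < d' * H ^ y" if "x < y" "c' < 2" "1 \<le> d'" for c' d' :: real and x y
  proof -
    have "c' * H ^ x < 2 * H ^ x" using that H by simp
    also have "\<dots> \<le> H ^ Suc x" using H by simp
    also have "\<dots> \<le> H ^ y" using that H by (intro power_increasing) auto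
    also have "\<dots> \<le> d' * H ^ y" using that H by simp
    finally show ?thesis .
  qed
  have "a = b" using lt[of a b c d] lt[of b a d c] c eq by (cases a b rule: linorder_cases) auto
  then show ?thesis using eq H by simp
qed

lemma card_block:
  fixes m L i :: nat
  assumes "i < m" "0 < L"
  shows "card {e \<in> {1..m * L}. (e - 1) div L = i} = L"
proof -
  have "{e \<in> {1..m * L}. (e - 1) div L = i} = {i * L<..i * L + L}"
  proof (intro set_eqI iffI)
    fix e assume "e \<in> {e \<in> {1..m * L}. (e - 1) div L = i}"
    then have e: "1 \<le> e" "(e - 1) div L = i" by auto
    then have "i * L + (e - 1) mod L = e - 1"
      using div_mult_mod_eq[of "e - 1" L] by simp
    moreover have "(e - 1) mod L < L" using assms by simp
    ultimately show "e \<in> {i * L<..i * L + L}"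
      unfolding greaterThanAtMost_iff using e(1) by linarith
  next
    fix e assume e: "e \<in> {i * L<..i * L + L}"
    have "Suc i * L \<le> m * L" using assms by (intro mult_right_mono) auto
    moreover have "(e - 1) div L = i"
      using e assms by (intro div_nat_eqI) (auto simp: mult.commute)
    ultimately show "e \<in> {e \<in> {1..m * L}. (e - 1) div L = i}" using e by auto
  qed
  then show ?thesis by simp
qed

section \<open>The hard instance and the averaging argument\<close>

theorem theorem2:
  fixes \<epsilon> :: real and k :: nat
  assumes "\<epsilon> > 0"
  shows "\<exists>n::nat. \<exists>M. matroid_on {1..n} M \<and> loopless_on {1..n} M \<and>
           (\<forall>A. \<not> competitive (mat_union M (union_pow (uniform1 {1..n}) k)) {1..n}
                     (1 / exp 1 + \<epsilon>) A)"
proof -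
  \<comment> \<open>Half of \<open>\<epsilon>\<close> goes to the single parts, the other half
    absorbs the \<open>k\<close> extras.\<close>
  define \<delta> where "\<delta> = \<epsilon> / 2"
  have \<delta>: "0 < \<delta>" using assms by (simp add: \<delta>_def)
  obtain L R H where L: "0 < L" and H: "2 \<le> H"
    and pos: "\<And>E. \<lbrakk>finite E; card E = L\<rbrakk> \<Longrightarrow> 0 < (\<Sum>z\<in>inj_configs E R. pmass E H z)"
    and hard: "\<And>E F A c v h es. \<lbrakk>finite E; card E = L; 0 \<le> c; distinct es; E \<subseteq> set es\<rbrakk> \<Longrightarrow>
       (\<Sum>z\<in>inj_configs E R. pmass E H z * first F A (\<lambda>e. if e \<in> E then c * H ^ z e else v e) E h es)
         \<le> c * ((1 / exp 1 + \<delta>) * (\<Sum>z\<in>inj_configs E R. rmass E z))"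
    by (rule single_part_hardness[OF \<delta>]) (rule that)
  define \<beta> where "\<beta> = 1 / exp 1 + \<delta>"
  note hard = hard [folded \<beta>_def]
  \<comment> \<open>\<open>2 * H ^ R\<close> bounds every weight, so with this many parts all extras
    together are worth less than \<open>\<delta> * m\<close>.\<close>
  obtain m :: nat where m: "real k * (2 * H ^ R) / \<delta> < real m"
    using reals_Archimedean2 by blast
  define N where "N = {1..m * L}"
  \<comment> \<open>Consecutive blocks of length \<open>L\<close>; the shift is due to the ground
    set starting at 1.\<close>
  define prt where "prt = (\<lambda>e::nat. (e - 1) div L)"
  define I where "I = {..<m}"
  define E where "E = (\<lambda>i. {e \<in> N. prt e = i})"
  define M where "M = {S. S \<subseteq> N \<and> inj_on prt S}"
  define F where "F = mat_union M (union_pow (uniform1 N) k)"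
  \<comment> \<open>Different parts may use the same exponents; distinct factors in
    \<open>[1, 2)\<close> keep all weights distinct.\<close>
  define c where "c = (\<lambda>i. 1 + real i / real m)"
  define C where "C = (\<lambda>i. inj_configs (E i) R)"
  define ZP where "ZP = (\<lambda>i. \<Sum>z\<in>C i. pmass (E i) H z)"
  define ZQ where "ZQ = (\<lambda>i. \<Sum>z\<in>C i. rmass (E i) z)"
  define p where "p = (\<lambda>i z. pmass (E i) H z / ZP i)"
  define P where "P = (\<lambda>x. \<Prod>i\<in>I. p i (x i))"
  define X where "X = Pi\<^sub>E I C"
  define W where "W = (\<lambda>x e. c (prt e) * H ^ (x (prt e) e))"
  \<comment> \<open>The expectation of the sum of the largest weights of the parts.\<close>
  define T where "T = (\<Sum>i\<in>I. c i * (ZQ i / ZP i))"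
  have finN: "finite N" and finI: "finite I" by (simp_all add: N_def I_def)
  have finE: "finite (E i)" for i using finN by (simp add: E_def)
  have finC: "finite (C i)" for i unfolding C_def by (rule finite_inj_configs[OF finE])
  have cardE: "card (E i) = L" if "i \<in> I" for i
    unfolding E_def N_def prt_def using that L by (intro card_block) (auto simp: I_def)
  have E0: "E i \<noteq> {}" if "i \<in> I" for i using cardE[OF that] L by auto
  have prtN: "prt e \<in> I" if "e \<in> N" for e
    using that L by (auto simp: prt_def N_def I_def less_mult_imp_div_less)
  have ZP0: "0 < ZP i" if "i \<in> I" for i
    unfolding ZP_def C_def using pos[OF finE cardE[OF that]] .
  have p0: "0 \<le> p i z" if "i \<in> I" for i z
    using ZP0[OF that] H unfolding p_def pmass_def
    by (intro divide_nonneg_pos divide_nonneg_nonneg rmass_nonneg) auto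
  have p1: "(\<Sum>z\<in>C i. p i z) = 1" if "i \<in> I" for i
    using ZP0[OF that] unfolding p_def by (simp add: sum_divide_distrib [symmetric] ZP_def)
  have P0: "0 \<le> P x" for x unfolding P_def using p0 by (intro prod_nonneg) auto
  have P1: "(\<Sum>x\<in>X. P x) = 1"
    unfolding P_def X_def using finI finC p1 by (subst prod_sum_PiE [symmetric]) auto
  have c: "1 \<le> c i \<and> c i < 2" if "i \<in> I" for i
    using that by (auto simp: c_def I_def)
  have xC: "x i \<in> E i \<rightarrow>\<^sub>E {1..R}" "inj_on (x i) (E i)" if "x \<in> X" "i \<in> I" for x i
    using PiE_mem[of x I C i] that by (auto simp: X_def C_def inj_configs_def)
  have W_bounds: "0 \<le> W x e" "W x e \<le> 2 * H ^ R" if x: "x \<in> X" and e: "e \<in> N" for x e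
  proof -
    have "x (prt e) e \<in> {1..R}"
      using PiE_mem[OF xC(1)[OF x prtN[OF e]], of e] e by (simp add: E_def)
    then have "H ^ x (prt e) e \<le> H ^ R" using H by (intro power_increasing) auto
    then show "0 \<le> W x e" "W x e \<le> 2 * H ^ R"
      unfolding W_def using c[OF prtN[OF e]] H by (simp_all add: mult_mono)
  qed
  have W_inj: "inj_on (W x) N" if x: "x \<in> X" for x
  proof (rule inj_onI)
    fix e e' assume e: "e \<in> N" "e' \<in> N" "W x e = W x e'"
    have "x (prt e) e = x (prt e') e' \<and> c (prt e) = c (prt e')"
      by (rule scaled_powers_inj[OF H]) (use e c prtN in \<open>auto simp: W_def\<close>)
    moreover have "prt e = prt e'" if "c (prt e) = c (prt e')"
      using that prtN[OF e(1)] by (auto simp: c_def I_def)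
    ultimately show "e = e'"
      using inj_onD[OF xC(2)[OF x prtN[OF e(1)]], of e e'] e by (auto simp: E_def)
  qed
  have T: "real m \<le> T"
  proof -
    have "1 \<le> c i * (ZQ i / ZP i)" if i: "i \<in> I" for i
    proof -
      have "ZP i \<le> ZQ i"
        unfolding ZP_def ZQ_def
      proof (rule sum_mono)
        fix z
        have "1 \<le> H ^ Max (z ` E i)" using H by simp
        then show "pmass (E i) H z \<le> rmass (E i) z"
          using divide_left_mono[of 1 "H ^ Max (z ` E i)" "rmass (E i) z"]
          by (simp add: pmass_def rmass_nonneg)
      qed
      then have "1 \<le> ZQ i / ZP i" using ZP0[OF i] by simp
      then show ?thesis using mult_mono[of 1 "c i" 1 "ZQ i / ZP i"] c[OF i] by simp
    qed
    then have "(\<Sum>i\<in>I. 1) \<le> T" unfolding T_def by (intro sum_mono) auto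
    then show ?thesis by (simp add: I_def)
  qed
  have alg: "(\<Sum>x\<in>X. P x * run F A (W x) [] \<sigma>) \<le> \<beta> * T + real k * (2 * H ^ R)"
    if \<sigma>: "\<sigma> \<in> permutations_of_set N" for A \<sigma>
  proof -
    have \<sigma>N: "set \<sigma> = N" "distinct \<sigma>" using \<sigma> by (auto simp: permutations_of_set_def)
    have path: "run F A (W x) [] \<sigma> \<le> (\<Sum>i\<in>I. first F A (W x) (E i) [] \<sigma>) + real k * (2 * H ^ R)"
      if x: "x \<in> X" for x
    proof -
      have "finite S \<and> card S \<le> card (prt ` S) + k" if "S \<in> F" for S
        using partition_union_bounds[OF finN, of S prt k] that finN finite_subset
        by (auto simp: F_def M_def)
      then show ?thesis
        using run_le_sum_first[of F prt k I N "W x" "2 * H ^ R" \<sigma> "[]" A] x finI prtN H \<sigma>N W_bounds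
        by (auto simp: E_def)
    qed
    have "(\<Sum>x\<in>X. P x * run F A (W x) [] \<sigma>)
        \<le> (\<Sum>x\<in>X. P x * ((\<Sum>i\<in>I. first F A (W x) (E i) [] \<sigma>) + real k * (2 * H ^ R)))"
      by (intro sum_mono mult_left_mono path P0)
    also have "\<dots> = (\<Sum>x\<in>X. \<Sum>i\<in>I. P x * first F A (W x) (E i) [] \<sigma>)
        + (\<Sum>x\<in>X. P x) * (real k * (2 * H ^ R))"
      by (simp only: distrib_left sum.distrib sum_distrib_left sum_distrib_right)
    also have "\<dots> = (\<Sum>i\<in>I. \<Sum>x\<in>X. P x * first F A (W x) (E i) [] \<sigma>) + real k * (2 * H ^ R)"
      by (subst sum.swap) (simp add: P1)
    also have "(\<Sum>i\<in>I. \<Sum>x\<in>X. P x * first F A (W x) (E i) [] \<sigma>)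
        \<le> (\<Sum>i\<in>I. \<beta> * (c i * (ZQ i / ZP i)))"
    proof (rule sum_mono)
      fix i assume i: "i \<in> I"
      show "(\<Sum>x\<in>X. P x * first F A (W x) (E i) [] \<sigma>) \<le> \<beta> * (c i * (ZQ i / ZP i))"
        unfolding P_def X_def
      proof (rule product_expectation_le[OF finI i finC p0 p1])
        fix x
        \<comment> \<open>With the other parts fixed by \<open>x\<close>, their weights act as the
          fixed \<open>v\<close> of the single-part bound.\<close>
        have W: "first F A (W (x(i := z))) (E i) [] \<sigma>
            = first F A (\<lambda>e. if e \<in> E i then c i * H ^ z e else W x e) (E i) [] \<sigma>" for z
          using \<sigma>N by (intro first_cong) (auto simp: W_def E_def)
        have "(\<Sum>z\<in>C i. p i z * first F A (W (x(i := z))) (E i) [] \<sigma>)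
            = (\<Sum>z\<in>C i. pmass (E i) H z * first F A (\<lambda>e. if e \<in> E i then c i * H ^ z e else W x e) (E i) [] \<sigma>) / ZP i"
          by (simp add: W p_def sum_divide_distrib)
        also have "\<dots> \<le> c i * (\<beta> * ZQ i) / ZP i"
          using ZP0[OF i] c[OF i] \<sigma>N unfolding C_def ZQ_def
          by (intro divide_right_mono hard finE cardE i) (auto simp: E_def)
        finally show "(\<Sum>z\<in>C i. p i z * first F A (W (x(i := z))) (E i) [] \<sigma>)
            \<le> \<beta> * (c i * (ZQ i / ZP i))"
          by (simp add: mult_ac)
      qed
    qed
    also have "(\<Sum>i\<in>I. \<beta> * (c i * (ZQ i / ZP i))) = \<beta> * T"
      by (simp add: T_def sum_distrib_left)
    finally show ?thesis by simp
  qed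
  have opt: "T \<le> (\<Sum>x\<in>X. P x * opt F (W x))"
  proof -
    have Max_le_opt: "(\<Sum>i\<in>I. c i * H ^ Max (x i ` E i)) \<le> opt F (W x)" for x
    proof -
      have "\<exists>e. e \<in> E i \<and> x i e = Max (x i ` E i)" if "i \<in> I" for i
        using Max_in[of "x i ` E i"] finE E0[OF that] by fastforce
      then obtain g where g: "\<And>i. i \<in> I \<Longrightarrow> g i \<in> E i \<and> x i (g i) = Max (x i ` E i)"
        by metis
      have "(\<Sum>i\<in>I. c i * H ^ Max (x i ` E i)) = (\<Sum>i\<in>I. W x (g i))"
        using g by (intro sum.cong) (auto simp: W_def E_def)
      also have "\<dots> \<le> opt F (W x)"
        unfolding F_def M_def using g by (intro sum_transversal_le_opt finN finI) (auto simp: E_def)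
      finally show ?thesis .
    qed
    have "T \<le> (\<Sum>i\<in>I. \<Sum>x\<in>X. P x * (c i * H ^ Max (x i ` E i)))"
      unfolding T_def
    proof (rule sum_mono)
      fix i assume i: "i \<in> I"
      \<comment> \<open>Negation turns the upper bound of \<open>product_expectation_le\<close> into
        the lower bound needed here.\<close>
      have "(\<Sum>x\<in>X. P x * (- (c i * H ^ Max (x i ` E i)))) \<le> - (c i * (ZQ i / ZP i))"
        unfolding P_def X_def
      proof (rule product_expectation_le[OF finI i finC p0 p1])
        fix x :: "nat \<Rightarrow> nat \<Rightarrow> nat"
        have "(\<Sum>z\<in>C i. p i z * (- (c i * H ^ Max ((x(i := z)) i ` E i))))
            = (\<Sum>z\<in>C i. - (c i * (rmass (E i) z / ZP i)))"
          using H by (intro sum.cong) (simp_all add: p_def pmass_def)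
        also have "\<dots> = - (c i * (ZQ i / ZP i))"
          by (simp add: ZQ_def sum_negf sum_distrib_left sum_divide_distrib)
        finally show "(\<Sum>z\<in>C i. p i z * (- (c i * H ^ Max ((x(i := z)) i ` E i))))
            \<le> - (c i * (ZQ i / ZP i))" by simp
      qed
      then show "c i * (ZQ i / ZP i) \<le> (\<Sum>x\<in>X. P x * (c i * H ^ Max (x i ` E i)))"
        by (simp add: sum_negf)
    qed
    also have "\<dots> = (\<Sum>x\<in>X. P x * (\<Sum>i\<in>I. c i * H ^ Max (x i ` E i)))"
      by (subst sum.swap) (simp add: sum_distrib_left)
    also have "\<dots> \<le> (\<Sum>x\<in>X. P x * opt F (W x))"
      by (intro sum_mono mult_left_mono Max_le_opt P0)
    finally show ?thesis .
  qed
  have "\<not> competitive F N (1 / exp 1 + \<epsilon>) A" for A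
  proof
    assume comp: "competitive F N (1 / exp 1 + \<epsilon>) A"
    let ?\<alpha> = "1 / exp 1 + \<epsilon>" and ?\<Pi> = "permutations_of_set N"
    have n\<Pi>: "0 < real (card ?\<Pi>)" using finN by simp
    have "?\<alpha> * T \<le> ?\<alpha> * (\<Sum>x\<in>X. P x * opt F (W x))"
      using opt assms by (intro mult_left_mono) auto
    also have "\<dots> = (\<Sum>x\<in>X. P x * (?\<alpha> * opt F (W x)))"
      by (simp add: sum_distrib_left mult_ac)
    \<comment> \<open>Averaging as in Yao's principle: the guarantee holds for each weight vector
      \<open>W x\<close>, hence on average over the prior.\<close>
    also have "\<dots> \<le> (\<Sum>x\<in>X. P x * expected_alg F N A (W x))"
      using comp W_bounds W_inj by (intro sum_mono mult_left_mono P0) (auto simp: competitive_def)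
    also have "\<dots> = (\<Sum>\<sigma>\<in>?\<Pi>. \<Sum>x\<in>X. P x * run F A (W x) [] \<sigma>) / real (card ?\<Pi>)"
      unfolding expected_alg_def
      by (subst sum.swap) (simp add: sum_distrib_left sum_divide_distrib)
    also have "\<dots> \<le> (\<Sum>\<sigma>\<in>?\<Pi>. \<beta> * T + real k * (2 * H ^ R)) / real (card ?\<Pi>)"
      using alg by (intro divide_right_mono sum_mono) auto
    also have "\<dots> = \<beta> * T + real k * (2 * H ^ R)"
      using n\<Pi> finN by simp
    finally have "\<delta> * T \<le> real k * (2 * H ^ R)"
      by (simp add: \<beta>_def \<delta>_def field_simps)
    moreover have "real k * (2 * H ^ R) < \<delta> * real m"
      using m \<delta> by (simp add: field_simps)
    moreover have "\<delta> * real m \<le> \<delta> * T"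
      using T \<delta> by simp
    ultimately show False by linarith
  qed
  then show ?thesis
    using partition_matroid[OF finN, of prt] unfolding F_def M_def N_def by blast
qed

end
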